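(* Fix a real number $p>2$ and fixed real numbers $0<t_1<t_2<t_3<t_4<t_5$. For $0<\varepsilon<t_5^{-1}$ and $i=1,\dots,5$ put $$P_i(\varepsilon)=\left(\bigl(1-(t_i\varepsilon)^p\bigr)^{1/p},\,t_i\varepsilon\right)\in S_p=\{(x,y)\in\mathbb{R}^2:|x|^p+|y|^p=1\}.$$ Then there is an $\varepsilon_0=\varepsilon_0(p,t_1,\dots,t_5)>0$ such that, whenever $0<\varepsilon<\varepsilon_0$ (and $\varepsilon<t_5^{-1}$), the unique conic through $P_1(\varepsilon),\dots,P_5(\varepsilon)$ is a nondegenerate hyperbola.
   Context: A conic in the real plane with affine coordinates $(u,y)$ is given by an equation $F+Ey+Cy^2+Du+Buy+Au^2=0$ with real coefficients not all zero, two equations being identified if they are proportional; "unique" means unique up to a nonzero scalar multiple of the equation. The conic is nondegenerate if the associated symmetric $3\times 3$ matrix of the quadratic form obtained by homogenizing is nonsingular. With discriminant $\Delta=B^2-4AC$, the conic is of hyperbolic type if $\Delta>0$ and of elliptic type if $\Delta<0$; a nondegenerate hyperbola is a nondegenerate conic of hyperbolic type. The type and nondegeneracy are invariant under invertible affine changes of coordinates, such as $u=1-x$, $y=y$ from the standard coordinates $(x,y)$. *)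

theory Defs
  imports "HOL-Analysis.Analysis"
begin

text \<open>
  The tuple \<open>(A, B, C, D, E, F)\<close> stands for the equation
  \<open>F + E y + C y\<^sup>2 + D u + B u y + A u\<^sup>2 = 0\<close>. Tuples carry the library's componentwise
  vector space structure, so \<open>q \<noteq> 0\<close> says that the coefficients are not all zero, and two
  equations define the same conic iff they differ by a nonzero scalar factor.
\<close>

type_synonym conic_eqn = "real \<times> real \<times> real \<times> real \<times> real \<times> real"

fun conic_eval :: "conic_eqn \<Rightarrow> real \<times> real \<Rightarrow> real" where
  "conic_eval (A, B, C, D, E, F) (u, y) =
     F + E * y + C * y\<^sup>2 + D * u + B * u * y + A * u\<^sup>2"

definition conic_through :: "conic_eqn \<Rightarrow> (real \<times> real) set \<Rightarrow> bool" where
  "conic_through q S \<longleftrightarrow> q \<noteq> 0 \<and> (\<forall>P\<in>S. conic_eval q P = 0)"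

definition same_conic :: "conic_eqn \<Rightarrow> conic_eqn \<Rightarrow> bool" where
  "same_conic q q' \<longleftrightarrow> (\<exists>c::real. c \<noteq> 0 \<and> q' = c *\<^sub>R q)"

text \<open>
  The symmetric matrix of the homogenized form
  \<open>A u\<^sup>2 + B u y + C y\<^sup>2 + D u w + E y w + F w\<^sup>2\<close> in the variables \<open>(u, y, w)\<close>.
\<close>

fun conic_matrix :: "conic_eqn \<Rightarrow> real ^ 3 ^ 3" where
  "conic_matrix (A, B, C, D, E, F) =
     vector [vector [A,     B / 2, D / 2],
             vector [B / 2, C,     E / 2],
             vector [D / 2, E / 2, F]]"

definition nondegenerate :: "conic_eqn \<Rightarrow> bool" where
  "nondegenerate q \<longleftrightarrow> invertible (conic_matrix q)"

fun conic_discriminant :: "conic_eqn \<Rightarrow> real" where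
  "conic_discriminant (A, B, C, D, E, F) = B\<^sup>2 - 4 * A * C"

definition hyperbolic_type :: "conic_eqn \<Rightarrow> bool" where
  "hyperbolic_type q \<longleftrightarrow> conic_discriminant q > 0"

definition nondegenerate_hyperbola :: "conic_eqn \<Rightarrow> bool" where
  "nondegenerate_hyperbola q \<longleftrightarrow> nondegenerate q \<and> hyperbolic_type q"

definition S_curve :: "real \<Rightarrow> (real \<times> real) set" where
  "S_curve p = {(x, y). \<bar>x\<bar> powr p + \<bar>y\<bar> powr p = 1}"

definition S_point :: "real \<Rightarrow> real \<Rightarrow> real \<times> real" where
  "S_point p s = ((1 - s powr p) powr (1 / p), s)"

text \<open>
  The coordinate change \<open>u = 1 - x\<close>: the equation \<open>q\<close> in \<open>(u, y)\<close>, rewritten in \<open>(x, y)\<close>. It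
  preserves the zero locus, the type and nondegeneracy, so it is immaterial in which of the two
  coordinate systems these notions are read.
\<close>

fun reflect_conic :: "conic_eqn \<Rightarrow> conic_eqn" where
  "reflect_conic (A, B, C, D, E, F) = (A, - B, C, - 2 * A - D, B + E, A + D + F)"

lemma conic_eval_reflect: "conic_eval (reflect_conic q) (x, y) = conic_eval q (1 - x, y)"
  by (cases q) (simp add: algebra_simps power2_eq_square)

lemma hyperbolic_type_reflect: "hyperbolic_type (reflect_conic q) \<longleftrightarrow> hyperbolic_type q"
  by (cases q) (simp add: hyperbolic_type_def)

lemma nondegenerate_reflect: "nondegenerate (reflect_conic q) \<longleftrightarrow> nondegenerate q"
proof -
  have "det (conic_matrix (reflect_conic q)) = det (conic_matrix q)"
    by (cases q) (simp add: det_3 vector_3 field_simps power2_eq_square)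
  then show ?thesis
    by (simp add: nondegenerate_def invertible_det_nz)
qed

end

theory Submission
  imports Defs "HOL-Real_Asymp.Real_Asymp"
begin

text \<open>
  In the coordinates \<open>v = (1 - x) / (\<epsilon>\<^sup>p / p)\<close>, \<open>t = y / \<epsilon>\<close> the five points converge to
  \<open>(t\<^sub>i\<^sup>p, t\<^sub>i)\<close>. A conic through the limit points is a combination of
  \<open>1, t, t\<^sup>2, t\<^sup>p, t\<^sup>p\<^sup>+\<^sup>1, t\<^sup>2\<^sup>p\<close> with five positive zeros; since \<open>p > 2\<close> these exponents increase,
  so by Descartes' rule the coefficients \<open>F, E, C, D, B, A\<close> alternate in sign and \<open>A C < 0\<close>.
  It is nondegenerate because a pair of lines would put three points of the strictly convex curve
  \<open>v = t\<^sup>p\<close> on a line. Both properties pass to small \<open>\<epsilon>\<close> by compactness. Uniqueness then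
  comes for free: two independent equations would have a nonzero combination with \<open>A = 0\<close>.
\<close>

section \<open>Rolle's theorem and the sign rule for sums of real powers\<close>

text \<open>Rolle is applied between neighbouring zeros. Interlacing makes the new zeros strictly
  increasing again, so the argument can be iterated.\<close>

lemma Rolle_sequence:
  fixes g g' :: "real \<Rightarrow> real" and z :: "nat \<Rightarrow> real"
  assumes "\<And>t. t > 0 \<Longrightarrow> (g has_real_derivative g' t) (at t)"
    and "\<And>i. i < Suc m \<Longrightarrow> 0 < z i \<and> g (z i) = 0"
    and "\<And>i. i < m \<Longrightarrow> z i < z (Suc i)"
  obtains y where "\<And>i. i < m \<Longrightarrow> 0 < y i \<and> g' (y i) = 0" "\<And>i. Suc i < m \<Longrightarrow> y i < y (Suc i)"
proof -
  have "\<exists>x. z i < x \<and> x < z (Suc i) \<and> g' x = 0" if "i < m" for i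
  proof -
    have z: "0 < z i" "z i < z (Suc i)" "g (z i) = g (z (Suc i))"
      using assms(2)[of i] assms(2)[of "Suc i"] assms(3)[of i] that by auto
    have "\<exists>x. z i < x \<and> x < z (Suc i) \<and> (\<lambda>d. g' x * d) = (\<lambda>d. 0)"
    proof (rule Rolle_deriv[OF z(2,3)])
      show "continuous_on {z i..z (Suc i)} g"
        using z by (intro DERIV_continuous_on[where D = g'] DERIV_subset[OF assms(1)]) auto
      show "(g has_derivative (\<lambda>d. g' x * d)) (at x)" if "z i < x" "x < z (Suc i)" for x
        using assms(1)[of x] that z by (simp add: has_field_derivative_def)
    qed
    then obtain x where x: "z i < x" "x < z (Suc i)" and "(\<lambda>d. g' x * d) = (\<lambda>d. 0)" by blast
    from fun_cong[OF this(3), of 1] x show ?thesis by auto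
  qed
  then obtain y where y: "\<And>i. i < m \<Longrightarrow> z i < y i \<and> y i < z (Suc i) \<and> g' (y i) = 0"
    by metis
  show ?thesis
  proof (rule that[of y])
    show "0 < y i \<and> g' (y i) = 0" if "i < m" for i
      using y[OF that] assms(2)[of i] that by fastforce
    show "y i < y (Suc i)" if "Suc i < m" for i
      using y[of i] y[of "Suc i"] that by fastforce
  qed
qed

text \<open>
  Extremal case of Descartes' rule of signs for real exponents. Dividing by the lowest power before
  differentiating removes the first term, dividing by the highest power removes the last one; the
  two resulting sums together see every pair of neighbouring coefficients.
\<close>

lemma powr_sum_alternating:
  fixes c e z :: "nat \<Rightarrow> real"
  assumes "\<And>i. i < n \<Longrightarrow> e i < e (Suc i)"
    and "\<And>i. i < n \<Longrightarrow> 0 < z i \<and> (\<Sum>j\<le>n. c j * z i powr e j) = 0"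
    and "\<And>i. Suc i < n \<Longrightarrow> z i < z (Suc i)"
    and "\<exists>i\<le>n. c i \<noteq> 0" and "k < n"
  shows "c k * c (Suc k) < 0"
  using assms
proof (induction n arbitrary: c e z k)
  case 0
  then show ?case by simp
next
  case (Suc m)
  have e_mono: "e i < e j" if "i < j" "j \<le> Suc m" for i j
    using that
  proof (induction j)
    case (Suc j)
    with Suc.prems show ?case using \<open>\<And>i. i < Suc m \<Longrightarrow> e i < e (Suc i)\<close>[of j]
      by (cases "i = j") auto
  qed simp
  have z0: "z 0 > 0" "(\<Sum>j\<le>Suc m. c j * z 0 powr e j) = 0" using Suc.prems(2)[of 0] by auto
  \<comment> \<open>A single nonzero term has no positive zero. Hence, when differentiation removes
    one term, some other coefficient is still nonzero, as the induction hypothesis demands.\<close>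
  have single: False if "l \<le> Suc m" "\<And>j. j \<le> Suc m \<Longrightarrow> j \<noteq> l \<Longrightarrow> c j = 0" for l
  proof -
    have "(\<Sum>j\<le>Suc m. c j * z 0 powr e j) = (\<Sum>j\<le>Suc m. if j = l then c l * z 0 powr e l else 0)"
      by (rule sum.cong) (use that in auto)
    also have "\<dots> = c l * z 0 powr e l"
      using that by simp
    finally have "c l = 0" using z0 by simp
    with that(2) Suc.prems(4) show False by metis
  qed
  \<comment> \<open>The factor \<open>t powr (- a)\<close> changes no positive zero. Differentiating
    then costs one zero and kills the term with exponent \<open>a\<close>, if there is one.\<close>
  have deriv_zeros: "\<exists>y. (\<forall>i<m. 0 < y i \<and> (\<Sum>j\<le>Suc m. c j * (e j - a) * y i powr (e j - a - 1)) = 0)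
      \<and> (\<forall>i. Suc i < m \<longrightarrow> y i < y (Suc i))" for a
  proof -
    define g where "g = (\<lambda>t. \<Sum>j\<le>Suc m. c j * t powr (e j - a))"
    have g: "g t = t powr (- a) * (\<Sum>j\<le>Suc m. c j * t powr e j)" for t
      unfolding g_def sum_distrib_left
      by (intro sum.cong) (auto simp: powr_diff powr_minus field_simps)
    have der: "(g has_real_derivative (\<Sum>j\<le>Suc m. c j * (e j - a) * t powr (e j - a - 1))) (at t)"
      if "t > 0" for t
      unfolding g_def
      by (intro DERIV_sum DERIV_cong[OF DERIV_cmult[OF has_real_derivative_powr[OF that]]]) simp
    obtain y where "\<And>i. i < m \<Longrightarrow> 0 < y i \<and> (\<Sum>j\<le>Suc m. c j * (e j - a) * y i powr (e j - a - 1)) = 0"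
        "\<And>i. Suc i < m \<Longrightarrow> y i < y (Suc i)"
    proof (rule Rolle_sequence[OF der])
      show "0 < z i \<and> g (z i) = 0" if "i < Suc m" for i
        using Suc.prems(2)[OF that] by (simp only: g) simp
      show "z i < z (Suc i)" if "i < m" for i
        using Suc.prems(3)[of i] that by simp
    qed auto
    then show ?thesis by blast
  qed
  show ?case
  proof (cases "m = 0")
    case True
    then have "k = 0" "c 0 * z 0 powr e 0 + c 1 * z 0 powr e 1 = 0" using z0 Suc.prems by auto
    moreover have "c 1 \<noteq> 0"
      using single[of 0] True by (metis One_nat_def le_Suc_eq le_zero_eq zero_le)
    moreover have "c 0 = - c 1 * (z 0 powr e 1 / z 0 powr e 0)"
      using calculation z0(1) by (simp add: field_simps)
    then have "c 0 * c 1 = - ((c 1)\<^sup>2 * (z 0 powr e 1 / z 0 powr e 0))"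
      by (simp add: power2_eq_square)
    moreover have "(c 1)\<^sup>2 * (z 0 powr e 1 / z 0 powr e 0) > 0"
      using \<open>c 1 \<noteq> 0\<close> z0(1) by (intro mult_pos_pos divide_pos_pos) auto
    ultimately show ?thesis by simp
  next
    case False
    show ?thesis
    proof (cases k)
      \<comment> \<open>With \<open>a = e 0\<close> the first term disappears and indices shift down
        by one. The new factors \<open>e j - e 0\<close> are positive, so signs of coefficients
        survive.\<close>
      case (Suc k')
      obtain y where y: "\<forall>i<m. 0 < y i \<and> (\<Sum>j\<le>Suc m. c j * (e j - e 0) * y i powr (e j - e 0 - 1)) = 0"
        "\<forall>i. Suc i < m \<longrightarrow> y i < y (Suc i)"
        using deriv_zeros[of "e 0"] by blast
      have "(c (Suc k') * (e (Suc k') - e 0)) * (c (Suc (Suc k')) * (e (Suc (Suc k')) - e 0)) < 0"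
      proof (rule Suc.IH[of "\<lambda>i. e (Suc i) - e 0 - 1" y "\<lambda>i. c (Suc i) * (e (Suc i) - e 0)"])
        show "0 < y i \<and> (\<Sum>j\<le>m. c (Suc j) * (e (Suc j) - e 0) * y i powr (e (Suc j) - e 0 - 1)) = 0"
          if "i < m" for i
          using y(1) that by (simp add: sum.atMost_Suc_shift del: sum.atMost_Suc)
        show "\<exists>i\<le>m. c (Suc i) * (e (Suc i) - e 0) \<noteq> 0"
        proof (rule ccontr)
          assume "\<not> ?thesis"
          then have "c (Suc i) = 0" if "i \<le> m" for i
            using e_mono[of 0 "Suc i"] that by fastforce
          then show False using single[of 0] by (metis Suc_le_mono not0_implies_Suc zero_le)
        qed
      qed (use Suc.prems y Suc in auto)
      moreover have "e (Suc k') - e 0 > 0" "e (Suc (Suc k')) - e 0 > 0"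
        using e_mono[of 0 "Suc k'"] e_mono[of 0 "Suc (Suc k')"] Suc.prems(5) Suc by auto
      ultimately show ?thesis
        using Suc by (auto simp: mult_less_0_iff zero_less_mult_iff)
    next
      \<comment> \<open>The pair of indices 0 and 1 needs the first term, so here the last one is
        removed.\<close>
      case 0
      let ?a = "e (Suc m)"
      obtain y where y: "\<forall>i<m. 0 < y i \<and> (\<Sum>j\<le>Suc m. c j * (e j - ?a) * y i powr (e j - ?a - 1)) = 0"
        "\<forall>i. Suc i < m \<longrightarrow> y i < y (Suc i)"
        using deriv_zeros[of ?a] by blast
      have "(c 0 * (e 0 - ?a)) * (c (Suc 0) * (e (Suc 0) - ?a)) < 0"
      proof (rule Suc.IH[of "\<lambda>i. e i - ?a - 1" y "\<lambda>i. c i * (e i - ?a)"])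
        show "\<exists>i\<le>m. c i * (e i - ?a) \<noteq> 0"
        proof (rule ccontr)
          assume "\<not> ?thesis"
          then have "c i = 0" if "i \<le> m" for i
            using e_mono[of i "Suc m"] that by fastforce
          then show False using single[of "Suc m"] by (metis le_Suc_eq order_refl)
        qed
      qed (use Suc.prems y False in auto)
      \<comment> \<open>Since \<open>m\<close> is not 0, index 1 is not the removed one. Both
        factors are negative, so the sign of the product is unchanged.\<close>
      moreover have "e 0 - ?a < 0" "e (Suc 0) - ?a < 0"
        using e_mono[of 0 "Suc m"] e_mono[of 1 "Suc m"] False by auto
      ultimately show ?thesis
        using 0 by (auto simp: mult_less_0_iff zero_less_mult_iff)
    qed
  qed
qed

section \<open>Conics through five points of the limit curve\<close>

text \<open>Strict convexity of \<open>t powr p\<close>, obtained here from the sign rule: a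
  non-vertical line meets the graph at most twice.\<close>

lemma linear_powr_three_zeros:
  fixes p a b c \<alpha> \<beta> \<gamma> :: real
  assumes "p > 1" "0 < a" "a < b" "b < c"
    and "\<alpha> + \<beta> * a + \<gamma> * a powr p = 0" "\<alpha> + \<beta> * b + \<gamma> * b powr p = 0"
      "\<alpha> + \<beta> * c + \<gamma> * c powr p = 0"
  shows "\<gamma> = 0"
proof (rule ccontr)
  assume "\<gamma> \<noteq> 0"
  \<comment> \<open>The padding term with exponent \<open>p + 1\<close> and coefficient 0 makes four
    terms for three zeros. Strict alternation would then give
    \<open>\<gamma> * 0 < 0\<close>.\<close>
  let ?c = "\<lambda>i. [\<alpha>, \<beta>, \<gamma>, 0] ! i" and ?e = "\<lambda>i. [0, 1, p, p + 1] ! i" and ?z = "\<lambda>i. [a, b, c] ! i"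
  have "?c 2 * ?c (Suc 2) < 0"
  proof (rule powr_sum_alternating[of 3 ?e ?z ?c])
    show "?e i < ?e (Suc i)" if "i < 3" for i
      using that assms by (auto simp: less_Suc_eq numeral_3_eq_3)
    show "0 < ?z i \<and> (\<Sum>j\<le>3. ?c j * ?z i powr ?e j) = 0" if "i < 3" for i
      using that assms by (auto simp: less_Suc_eq numeral_3_eq_3)
    show "?z i < ?z (Suc i)" if "Suc i < 3" for i
      using that assms by (auto simp: less_Suc_eq numeral_3_eq_3)
    show "\<exists>i\<le>3. ?c i \<noteq> 0"
      using \<open>\<gamma> \<noteq> 0\<close> by (intro exI[of _ 2]) simp
  qed simp
  then show False by simp
qed

text \<open>\<open>A * C < 0\<close> is stronger than a positive discriminant and not affinely
  invariant. It is an open condition, survives reflection and axis-parallel scaling, and yields the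
  \<open>A \<noteq> 0\<close> on which uniqueness rests.\<close>

fun strongly_hyperbolic :: "conic_eqn \<Rightarrow> bool" where
  "strongly_hyperbolic (A, B, C, D, E, F) \<longleftrightarrow>
     A * C < 0 \<and> det (conic_matrix (A, B, C, D, E, F)) \<noteq> 0"

lemma det_conic_matrix:
  "det (conic_matrix (A, B, C, D, E, F)) =
     A * C * F + B * D * E / 4 - A * E\<^sup>2 / 4 - C * D\<^sup>2 / 4 - F * B\<^sup>2 / 4"
  by (simp add: det_3 vector_3 field_simps power2_eq_square)

lemma strongly_hyperbolic_imp_nondegenerate_hyperbola:
  assumes "strongly_hyperbolic q"
  shows "nondegenerate_hyperbola q"
proof (cases q)
  case (fields A B C D E F)
  with assms have "A * C < 0" by simp
  then have "0 < B\<^sup>2 - 4 * A * C" using zero_le_power2[of B] by linarith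
  with fields assms show ?thesis
    by (simp add: nondegenerate_hyperbola_def nondegenerate_def invertible_det_nz hyperbolic_type_def)
qed

text \<open>Completing the square in \<open>u\<close> writes \<open>4 * A\<close> times the equation
  as a square minus a quadratic in \<open>y\<close> with leading coefficient
  \<open>\<Delta> > 0\<close>. A vanishing determinant makes that quadratic
  \<open>\<Delta> * (y + m)\<^sup>2\<close>, and the difference of squares splits into real
  lines.\<close>

lemma degenerate_hyperbolic_lines:
  fixes A B C D E F :: real
  assumes "A * C < 0" "det (conic_matrix (A, B, C, D, E, F)) = 0"
  obtains \<alpha> \<beta> \<alpha>' \<beta>' where
    "\<And>u y. conic_eval (A, B, C, D, E, F) (u, y) = 0 \<Longrightarrow>
       \<alpha> + \<beta> * y + 2 * A * u = 0 \<or> \<alpha>' + \<beta>' * y + 2 * A * u = 0"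
proof -
  define \<Delta> where "\<Delta> = B\<^sup>2 - 4 * A * C"
  define m where "m = (B * D - 2 * A * E) / \<Delta>"
  define r where "r = sqrt \<Delta>"
  have "\<Delta> > 0" unfolding \<Delta>_def using assms(1) zero_le_power2[of B] by linarith
  then have r: "r\<^sup>2 = \<Delta>" by (simp add: r_def)
  have "(B * D - 2 * A * E)\<^sup>2 - \<Delta> * (D\<^sup>2 - 4 * A * F) = -16 * A * det (conic_matrix (A, B, C, D, E, F))"
    unfolding det_conic_matrix \<Delta>_def by (simp add: field_simps power2_eq_square)
  then have "\<Delta> * (D\<^sup>2 - 4 * A * F) = (m * \<Delta>)\<^sup>2"
    using assms(2) \<open>\<Delta> > 0\<close> by (simp add: m_def)
  then have "\<Delta> * (D\<^sup>2 - 4 * A * F) = \<Delta> * (\<Delta> * m\<^sup>2)"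
    by (simp add: power2_eq_square mult_ac)
  then have m: "D\<^sup>2 - 4 * A * F = \<Delta> * m\<^sup>2" "B * D - 2 * A * E = \<Delta> * m"
    using \<open>\<Delta> > 0\<close> by (simp_all add: m_def)
  show ?thesis
  proof (rule that[of "D - r * m" "B - r" "D + r * m" "B + r"])
    fix u y assume *: "conic_eval (A, B, C, D, E, F) (u, y) = 0"
    have "(D - r * m + (B - r) * y + 2 * A * u) * (D + r * m + (B + r) * y + 2 * A * u)
        = (2 * A * u + B * y + D)\<^sup>2 - r\<^sup>2 * (y + m)\<^sup>2"
      by (simp add: algebra_simps power2_eq_square)
    also have "\<dots> = (2 * A * u + B * y + D)\<^sup>2 - (\<Delta> * y\<^sup>2 + 2 * (\<Delta> * m) * y + \<Delta> * m\<^sup>2)"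
      unfolding r by (simp add: algebra_simps power2_eq_square)
    also have "\<dots> = (2 * A * u + B * y + D)\<^sup>2
        - (\<Delta> * y\<^sup>2 + 2 * (B * D - 2 * A * E) * y + (D\<^sup>2 - 4 * A * F))"
      by (simp only: m)
    also have "\<dots> = 4 * A * conic_eval (A, B, C, D, E, F) (u, y)"
      unfolding \<Delta>_def by (simp add: algebra_simps power2_eq_square)
    finally show "D - r * m + (B - r) * y + 2 * A * u = 0 \<or> D + r * m + (B + r) * y + 2 * A * u = 0"
      using * by simp
  qed
qed

lemma strongly_hyperbolic_through_powr_graph:
  fixes p :: real and t :: "nat \<Rightarrow> real"
  assumes "p > 2" and t0: "\<And>i. i < 5 \<Longrightarrow> 0 < t i" and t: "\<And>i. Suc i < 5 \<Longrightarrow> t i < t (Suc i)"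
    and "q \<noteq> 0" and q: "\<And>i. i < 5 \<Longrightarrow> conic_eval q (t i powr p, t i) = 0"
  shows "strongly_hyperbolic q"
proof (cases q)
  case (fields A B C D E F)
  \<comment> \<open>Substituting \<open>u = t powr p\<close>, \<open>y = t\<close> turns the
    equation into this sum. The order \<open>2 < p\<close> puts the coefficients in the sequence
    \<open>F, E, C, D, B, A\<close>.\<close>
  let ?c = "\<lambda>i. [F, E, C, D, B, A] ! i" and ?e = "\<lambda>i. [0, 1, 2, p, p + 1, 2 * p] ! i"
  have alt: "?c k * ?c (Suc k) < 0" if "k < 5" for k
  proof (rule powr_sum_alternating[of 5 ?e t ?c])
    show "?e i < ?e (Suc i)" if "i < 5" for i
      using that assms(1) by (auto simp: less_Suc_eq eval_nat_numeral)
    show "0 < t i \<and> (\<Sum>j\<le>5. ?c j * t i powr ?e j) = 0" if "i < 5" for i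
    proof -
      have "t i powr 2 = (t i)\<^sup>2" "t i powr (p + 1) = t i powr p * t i" "t i powr (2 * p) = (t i powr p)\<^sup>2"
        using t0[OF that] powr_add[of "t i" p p] by (simp_all add: powr_add powr_numeral power2_eq_square)
      moreover have "{..5::nat} = {0, 1, 2, 3, 4, 5}" by auto
      ultimately show ?thesis
        using q[OF that] t0[OF that] fields by (simp add: algebra_simps)
    qed
    show "\<exists>i\<le>5. ?c i \<noteq> 0"
    proof (rule ccontr)
      assume "\<not> ?thesis"
      then have "?c k = 0" if "k \<le> 5" for k using that by blast
      from this[of 0] this[of 1] this[of 2] this[of 3] this[of 4] this[of 5]
      show False using \<open>q \<noteq> 0\<close> fields by (simp add: zero_prod_def)
    qed
  qed (use t that in auto)
  \<comment> \<open>Three sign changes lead from \<open>C\<close> through \<open>D\<close> and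
    \<open>B\<close> to \<open>A\<close>.\<close>
  have "A * C < 0"
    using alt[of 2] alt[of 3] alt[of 4] by (auto simp: mult_less_0_iff)
  moreover have False if det: "det (conic_matrix (A, B, C, D, E, F)) = 0"
  proof -
    obtain \<alpha> \<beta> \<alpha>' \<beta>' where lines:
      "\<And>u y. conic_eval (A, B, C, D, E, F) (u, y) = 0 \<Longrightarrow>
         \<alpha> + \<beta> * y + 2 * A * u = 0 \<or> \<alpha>' + \<beta>' * y + 2 * A * u = 0"
      using degenerate_hyperbolic_lines[OF \<open>A * C < 0\<close> det] by blast
    \<comment> \<open>Both lines have the coefficient \<open>2 * A\<close> of \<open>u\<close>, so
      three of the points on one line would force \<open>A = 0\<close>.\<close>
    have no3: False if "i < j" "j < k" "k < 5" and l: "\<And>n. n \<in> {i, j, k} \<Longrightarrow> a + b * t n + 2 * A * t n powr p = 0"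
      for a b i j k
    proof -
      have "t m < t n" if "m < n" "n < 5" for m n
        using that
      proof (induction n)
        case (Suc n)
        then show ?case using t[of n] by (cases "m = n") auto
      qed simp
      then have "2 * A = 0"
        using linear_powr_three_zeros[of p "t i" "t j" "t k" a b "2 * A"] that t0[of i] \<open>p > 2\<close> by auto
      with \<open>A * C < 0\<close> show False by simp
    qed
    \<comment> \<open>Pigeonhole: two lines cover five points, so one of them carries three. All ten
      triples are listed, which leaves a propositional contradiction.\<close>
    define L where "L = (\<lambda>n. \<alpha> + \<beta> * t n + 2 * A * t n powr p = 0)"
    define L' where "L' = (\<lambda>n. \<alpha>' + \<beta>' * t n + 2 * A * t n powr p = 0)"
    have or: "L n \<or> L' n" if "n < 5" for n
      using lines q[OF that] fields by (simp add: L_def L'_def)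
    have "\<not> (L i \<and> L j \<and> L k)" "\<not> (L' i \<and> L' j \<and> L' k)" if "i < j" "j < k" "k < 5" for i j k
      using no3[OF that] by (auto simp: L_def L'_def)
    from this[of 0 1 2] this[of 0 1 3] this[of 0 1 4] this[of 0 2 3] this[of 0 2 4] this[of 0 3 4]
      this[of 1 2 3] this[of 1 2 4] this[of 1 3 4] this[of 2 3 4]
      or[of 0] or[of 1] or[of 2] or[of 3] or[of 4]
    show False by simp argo
  qed
  ultimately show ?thesis using fields by auto
qed

section \<open>Changes of coordinates and rescaling of equations\<close>

fun scale_conic :: "real \<Rightarrow> real \<Rightarrow> conic_eqn \<Rightarrow> conic_eqn" where
  "scale_conic a b (A, B, C, D, E, F) = (a\<^sup>2 * A, a * b * B, b\<^sup>2 * C, a * D, b * E, F)"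

lemma conic_eval_scale: "conic_eval (scale_conic a b q) (u, y) = conic_eval q (a * u, b * y)"
  by (cases q) (simp add: algebra_simps power2_eq_square)

lemma strongly_hyperbolic_scale:
  assumes "a \<noteq> 0" "b \<noteq> 0"
  shows "strongly_hyperbolic (scale_conic a b q) \<longleftrightarrow> strongly_hyperbolic q"
proof (cases q)
  case (fields A B C D E F)
  have "det (conic_matrix (scale_conic a b q)) = (a * b)\<^sup>2 * det (conic_matrix q)"
    unfolding fields scale_conic.simps det_conic_matrix by (simp add: field_simps power2_eq_square)
  moreover have "(a\<^sup>2 * A) * (b\<^sup>2 * C) = (a * b)\<^sup>2 * (A * C)"
    by (simp add: power2_eq_square)
  moreover have "(a * b)\<^sup>2 > 0" using assms by simp
  ultimately show ?thesis
    unfolding fields scale_conic.simps strongly_hyperbolic.simps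
    by (metis mult_eq_0_iff mult_less_0_iff order_less_asym)
qed

lemma strongly_hyperbolic_reflect: "strongly_hyperbolic (reflect_conic q) \<longleftrightarrow> strongly_hyperbolic q"
proof -
  have "det (conic_matrix (reflect_conic q)) \<noteq> 0 \<longleftrightarrow> det (conic_matrix q) \<noteq> 0"
    using nondegenerate_reflect[of q] by (simp add: nondegenerate_def invertible_det_nz)
  then show ?thesis by (cases q) (simp del: conic_matrix.simps)
qed

lemma scale_conic_eq_0: "a \<noteq> 0 \<Longrightarrow> b \<noteq> 0 \<Longrightarrow> scale_conic a b q = 0 \<longleftrightarrow> q = 0"
  by (cases q) (simp add: zero_prod_def)

lemma reflect_conic_eq_0: "reflect_conic q = 0 \<longleftrightarrow> q = 0"
  by (cases q) (auto simp: zero_prod_def)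

text \<open>Pairing with the vector of monomials gives linearity in the equation, joint continuity
  in equation and point, and existence by a dimension count.\<close>

lemma conic_eval_conv_inner:
  "conic_eval q (u, y) = inner q (u\<^sup>2, u * y, y\<^sup>2, u, y, 1)"
  by (cases q) (simp add: inner_prod_def algebra_simps)

lemma conic_eval_scaleR: "conic_eval (c *\<^sub>R q) P = c * conic_eval q P"
  by (cases P) (simp add: conic_eval_conv_inner)

lemma conic_eval_diff: "conic_eval (q - q') P = conic_eval q P - conic_eval q' P"
  by (cases P) (simp add: conic_eval_conv_inner inner_diff_left)

lemma strongly_hyperbolic_scaleR:
  assumes "c \<noteq> 0"
  shows "strongly_hyperbolic (c *\<^sub>R q) \<longleftrightarrow> strongly_hyperbolic q"
proof (cases q)
  case (fields A B C D E F)
  have "det (conic_matrix (c *\<^sub>R q)) = c ^ 3 * det (conic_matrix q)"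
    unfolding fields scaleR_Pair det_conic_matrix by (simp add: field_simps power2_eq_square power3_eq_cube)
  moreover have "(c * A) * (c * C) = c\<^sup>2 * (A * C)"
    by (simp add: power2_eq_square)
  moreover have "c\<^sup>2 > 0" using assms by simp
  ultimately show ?thesis
    using assms unfolding fields scaleR_Pair strongly_hyperbolic.simps real_scaleR_def
    by (metis mult_eq_0_iff mult_less_0_iff order_less_asym power_not_zero)
qed

section \<open>Passing from the limit points to small parameters\<close>

text \<open>Both defining conditions are open: \<open>ac\<close> and \<open>dt\<close> are
  polynomials in the coefficients, hence continuous.\<close>

lemma strongly_hyperbolic_limit:
  assumes "Q \<longlonglongrightarrow> q" "strongly_hyperbolic q"
  shows "eventually (\<lambda>n. strongly_hyperbolic (Q n)) sequentially"
proof -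
  define ac :: "conic_eqn \<Rightarrow> real" where "ac = (\<lambda>(A, B, C, D, E, F). A * C)"
  define dt :: "conic_eqn \<Rightarrow> real" where "dt = (\<lambda>(A, B, C, D, E, F).
    A * C * F + B * D * E / 4 - A * E\<^sup>2 / 4 - C * D\<^sup>2 / 4 - F * B\<^sup>2 / 4)"
  have iff: "strongly_hyperbolic q \<longleftrightarrow> ac q < 0 \<and> dt q \<noteq> 0" for q
    by (cases q) (simp add: ac_def dt_def det_conic_matrix del: conic_matrix.simps)
  have "(\<lambda>n. ac (Q n)) \<longlonglongrightarrow> ac q" "(\<lambda>n. dt (Q n)) \<longlonglongrightarrow> dt q"
    unfolding ac_def dt_def case_prod_unfold by (intro tendsto_intros assms; simp)+
  with assms(2) have "eventually (\<lambda>n. ac (Q n) < 0) sequentially"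
    "eventually (\<lambda>n. dt (Q n) \<noteq> 0) sequentially"
    unfolding iff by (auto intro: order_tendstoD tendsto_imp_eventually_ne)
  then show ?thesis unfolding iff by (rule eventually_conj)
qed

text \<open>
  Compactness of the unit sphere of equations: equations violating the conclusion for parameters
  tending to zero would accumulate at one that violates it for the limit points.
\<close>

lemma eventually_strongly_hyperbolic:
  fixes X :: "nat \<Rightarrow> real \<Rightarrow> real \<times> real"
  assumes X: "\<And>i. i < m \<Longrightarrow> (X i \<longlongrightarrow> L i) (at_right 0)"
    and L: "\<And>q. q \<noteq> 0 \<Longrightarrow> (\<And>i. i < m \<Longrightarrow> conic_eval q (L i) = 0) \<Longrightarrow> strongly_hyperbolic q"
  shows "eventually (\<lambda>\<epsilon>. \<forall>q. q \<noteq> 0 \<longrightarrow> (\<forall>i<m. conic_eval q (X i \<epsilon>) = 0) \<longrightarrow> strongly_hyperbolic q)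
           (at_right 0)"
proof (rule ccontr)
  let ?R = "\<lambda>\<epsilon> q. (\<forall>i<m. conic_eval q (X i \<epsilon>) = 0) \<and> \<not> strongly_hyperbolic q"
  assume not_ev: "\<not> ?thesis"
  have "\<exists>\<epsilon> q. 0 < \<epsilon> \<and> \<epsilon> < 1 / real (Suc n) \<and> norm q = 1 \<and> ?R \<epsilon> q" for n
  proof -
    have "\<exists>\<epsilon>>0. \<epsilon> < 1 / real (Suc n) \<and> (\<exists>q. q \<noteq> 0 \<and> ?R \<epsilon> q)"
    proof (rule ccontr)
      assume "\<not> ?thesis"
      then have "\<forall>\<epsilon>>0. \<epsilon> < 1 / real (Suc n) \<longrightarrow>
          (\<forall>q. q \<noteq> 0 \<longrightarrow> (\<forall>i<m. conic_eval q (X i \<epsilon>) = 0) \<longrightarrow> strongly_hyperbolic q)" by blast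
      with not_ev show False
        unfolding eventually_at_right_field by (metis of_nat_0_less_iff zero_less_Suc zero_less_divide_1_iff)
    qed
    then obtain \<epsilon> q where \<epsilon>: "0 < \<epsilon>" "\<epsilon> < 1 / real (Suc n)" "q \<noteq> 0" "?R \<epsilon> q" by blast
    \<comment> \<open>Vanishing at the points and failure of \<open>strongly_hyperbolic\<close> are
      invariant under nonzero factors, so the counterexample can be moved to the unit
      sphere.\<close>
    then have "norm (inverse (norm q) *\<^sub>R q) = 1" "?R \<epsilon> (inverse (norm q) *\<^sub>R q)"
      by (simp_all add: conic_eval_scaleR strongly_hyperbolic_scaleR)
    with \<epsilon> show ?thesis by blast
  qed
  then obtain h Q where h: "\<And>n. 0 < h n" "\<And>n. h n < 1 / real (Suc n)"
    and Q: "\<And>n. norm (Q n) = 1" "\<And>n. ?R (h n) (Q n)"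
    by metis
  have "h \<longlonglongrightarrow> 0"
  proof (rule tendsto_sandwich[OF _ _ tendsto_const LIMSEQ_inverse_real_of_nat])
    show "\<forall>\<^sub>F n in sequentially. h n \<le> inverse (real (Suc n))"
      using h(2) by (simp add: inverse_eq_divide less_imp_le del: of_nat_Suc)
  qed (simp add: h(1) less_imp_le)
  have "compact (sphere (0::conic_eqn) 1)" by simp
  then obtain q r where q: "q \<in> sphere 0 1" "strict_mono r" "(Q \<circ> r) \<longlonglongrightarrow> q"
    unfolding compact_def using Q(1) by (metis mem_sphere_0)
  have "(h \<circ> r) \<longlonglongrightarrow> 0" using LIMSEQ_subseq_LIMSEQ[OF \<open>h \<longlonglongrightarrow> 0\<close> q(2)] .
  then have hr: "filterlim (h \<circ> r) (at_right 0) sequentially"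
    using h(1) by (simp add: filterlim_at order_less_imp_not_eq2)
  have "conic_eval q (L i) = 0" if "i < m" for i
  proof -
    have "(\<lambda>n. X i ((h \<circ> r) n)) \<longlonglongrightarrow> L i"
      by (rule filterlim_compose[OF X[OF that] hr])
    \<comment> \<open>Equation and point vary together along the sequence; the inner product form
      makes this a limit of a continuous expression.\<close>
    moreover have ev: "conic_eval q P = inner q ((fst P)\<^sup>2, fst P * snd P, (snd P)\<^sup>2, fst P, snd P, 1)" for q P
      by (cases P) (simp add: conic_eval_conv_inner)
    ultimately have "(\<lambda>n. conic_eval ((Q \<circ> r) n) (X i ((h \<circ> r) n))) \<longlonglongrightarrow> conic_eval q (L i)"
      unfolding ev by (intro tendsto_intros q(3))
    moreover have "conic_eval ((Q \<circ> r) n) (X i ((h \<circ> r) n)) = 0" for n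
      using Q(2) that by simp
    ultimately show ?thesis by (simp add: LIMSEQ_const_iff)
  qed
  moreover have "q \<noteq> 0" using q(1) by (metis mem_sphere_0 norm_zero zero_neq_one)
  ultimately have "strongly_hyperbolic q" using L by blast
  from strongly_hyperbolic_limit[OF q(3) this] Q(2) show False by simp
qed

section \<open>Existence and uniqueness of the conic\<close>

text \<open>At most five monomial vectors span a proper subspace of the six-dimensional space of
  equations; a nonzero vector orthogonal to it is the required equation.\<close>

lemma ex_conic_through:
  assumes "finite S" "card S < 6"
  shows "\<exists>q. conic_through q S"
proof -
  let ?m = "\<lambda>(u, y). (u\<^sup>2, u * y, y\<^sup>2, u, y, 1) :: conic_eqn"
  have "dim (?m ` S) \<le> card (?m ` S)" using assms by (intro dim_le_card') auto
  also have "\<dots> < DIM(conic_eqn)" using card_image_le[OF assms(1), of ?m] assms(2) by simp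
  finally obtain q where "q \<noteq> 0" "\<And>w. w \<in> span (?m ` S) \<Longrightarrow> orthogonal q w"
    using orthogonal_to_subspace_exists by blast
  then have "conic_through q S"
    unfolding conic_through_def by (force simp: conic_eval_conv_inner orthogonal_def intro: span_base)
  then show ?thesis ..
qed

lemma same_conic_if_all_strongly_hyperbolic:
  assumes "\<And>q. conic_through q S \<Longrightarrow> strongly_hyperbolic q"
    and q: "conic_through q S" and q': "conic_through q' S"
  shows "same_conic q q'"
proof -
  have nz: "fst w \<noteq> 0" if "strongly_hyperbolic w" for w
    using that by (cases w) auto
  have f: "fst q \<noteq> 0" "fst q' \<noteq> 0" using assms nz by auto
  \<comment> \<open>This combination cancels the first component \<open>A\<close>. If it were
    nonzero, it would be a conic through \<open>S\<close> and so have
    \<open>A \<noteq> 0\<close>.\<close>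
  define w where "w = fst q' *\<^sub>R q - fst q *\<^sub>R q'"
  have "fst w = 0" by (simp add: w_def)
  moreover have "conic_eval w P = 0" if "P \<in> S" for P
    using q q' that by (simp add: conic_through_def w_def conic_eval_diff conic_eval_scaleR)
  ultimately have "w = 0" using assms(1)[of w] nz[of w] unfolding conic_through_def by blast
  then have "fst q *\<^sub>R q' = fst q' *\<^sub>R q" by (simp add: w_def)
  then have "inverse (fst q) *\<^sub>R (fst q *\<^sub>R q') = (fst q' / fst q) *\<^sub>R q"
    by (simp add: divide_inverse_commute)
  then have "q' = (fst q' / fst q) *\<^sub>R q" using f by simp
  with f show ?thesis unfolding same_conic_def by (intro exI[of _ "fst q' / fst q"]) simp
qed

section \<open>The points on the curve and their rescaled limits\<close>

lemma S_point_mem_S_curve: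
  assumes "p > 0" "0 < s" "s < 1"
  shows "S_point p s \<in> S_curve p"
proof -
  have "s powr p \<le> 1" using assms powr_le1[of p s] by simp
  with assms show ?thesis by (simp add: S_point_def S_curve_def powr_powr)
qed

text \<open>First-order expansion: \<open>1 - (1 - s) powr (1 / p)\<close> behaves like
  \<open>s / p\<close> as \<open>s\<close> tends to 0, which explains the divisor. It is proved in
  the variable \<open>\<delta>\<close>, for which \<open>\<epsilon> powr p\<close> is then
  substituted.\<close>

lemma S_point_rescaled_limit:
  fixes p t :: real
  assumes "p > 0" "t > 0"
  shows "((\<lambda>\<epsilon>. (1 - fst (S_point p (t * \<epsilon>))) / (\<epsilon> powr p / p)) \<longlongrightarrow> t powr p) (at_right 0)"
proof -
  have "((\<lambda>\<delta>. (1 - (1 - t powr p * \<delta>) powr (1 / p)) / (\<delta> / p)) \<longlongrightarrow> t powr p) (at_right 0)"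
    using assms by real_asymp
  moreover have "filterlim (\<lambda>\<epsilon>. \<epsilon> powr p) (at_right 0) (at_right 0)"
    using assms by real_asymp
  ultimately have "((\<lambda>\<epsilon>. (1 - (1 - t powr p * \<epsilon> powr p) powr (1 / p)) / (\<epsilon> powr p / p)) \<longlongrightarrow> t powr p) (at_right 0)"
    by (rule filterlim_compose)
  then show ?thesis
    by (rule Lim_transform_eventually)
      (use assms in \<open>auto simp: S_point_def powr_mult eventually_at_right_field intro!: exI[of _ 1]\<close>)
qed

theorem theorem2:
  fixes p t1 t2 t3 t4 t5 :: real
  fixes P :: "real \<Rightarrow> (real \<times> real) set"
  assumes "p > 2"
    and "0 < t1" and "t1 < t2" and "t2 < t3" and "t3 < t4" and "t4 < t5"
  defines "P \<equiv> (\<lambda>\<epsilon>. {S_point p (t1 * \<epsilon>), S_point p (t2 * \<epsilon>), S_point p (t3 * \<epsilon>),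
                     S_point p (t4 * \<epsilon>), S_point p (t5 * \<epsilon>)})"
  shows "(\<forall>\<epsilon>. 0 < \<epsilon> \<and> \<epsilon> < inverse t5 \<longrightarrow> P \<epsilon> \<subseteq> S_curve p) \<and>
    (\<exists>\<epsilon>0>0. \<forall>\<epsilon>. 0 < \<epsilon> \<and> \<epsilon> < \<epsilon>0 \<and> \<epsilon> < inverse t5 \<longrightarrow>
      (\<exists>q. conic_through q (P \<epsilon>) \<and>
           (\<forall>q'. conic_through q' (P \<epsilon>) \<longrightarrow> same_conic q q') \<and>
           nondegenerate_hyperbola q))"
proof (intro conjI allI impI)
  fix \<epsilon> assume \<epsilon>: "0 < \<epsilon> \<and> \<epsilon> < inverse t5"
  then have "t5 * \<epsilon> < 1" using assms by (simp add: field_simps)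
  have "S_point p (s * \<epsilon>) \<in> S_curve p" if "0 < s" "s \<le> t5" for s
  proof (rule S_point_mem_S_curve)
    show "s * \<epsilon> < 1" using that \<epsilon> by (intro le_less_trans[OF mult_right_mono \<open>t5 * \<epsilon> < 1\<close>]) auto
  qed (use that \<epsilon> assms(1) in auto)
  with assms show "P \<epsilon> \<subseteq> S_curve p" by auto
next
  define t where "t = (\<lambda>i. [t1, t2, t3, t4, t5] ! i)"
  define v where "v = (\<lambda>\<epsilon> s. (1 - fst (S_point p (s * \<epsilon>))) / (\<epsilon> powr p / p))"
  have t0: "0 < t i" if "i < 5" for i
    using that assms by (auto simp: t_def less_Suc_eq eval_nat_numeral)
  have t: "t i < t (Suc i)" if "Suc i < 5" for i
    using that assms by (auto simp: t_def less_Suc_eq eval_nat_numeral)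
  have P: "P \<epsilon> = (\<lambda>i. S_point p (t i * \<epsilon>)) ` {..<5}" for \<epsilon>
    by (auto simp: P_def t_def lessThan_Suc eval_nat_numeral)
  have "eventually (\<lambda>\<epsilon>. \<forall>q. q \<noteq> 0 \<longrightarrow> (\<forall>i<5. conic_eval q (v \<epsilon> (t i), t i) = 0) \<longrightarrow> strongly_hyperbolic q)
      (at_right 0)"
  proof (rule eventually_strongly_hyperbolic)
    show "((\<lambda>\<epsilon>. (v \<epsilon> (t i), t i)) \<longlongrightarrow> (t i powr p, t i)) (at_right 0)" if "i < 5" for i
      unfolding v_def using t0[OF that] assms(1)
      by (intro tendsto_Pair S_point_rescaled_limit tendsto_const) auto
    show "strongly_hyperbolic q"
      if "q \<noteq> 0" "\<And>i. i < 5 \<Longrightarrow> conic_eval q (t i powr p, t i) = 0" for q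
      by (rule strongly_hyperbolic_through_powr_graph[where t = t and p = p]) (use that t0 t assms(1) in auto)
  qed
  then obtain \<epsilon>0 where "\<epsilon>0 > 0" and \<epsilon>0: "\<And>\<epsilon> q. 0 < \<epsilon> \<Longrightarrow> \<epsilon> < \<epsilon>0 \<Longrightarrow> q \<noteq> 0 \<Longrightarrow>
      (\<And>i. i < 5 \<Longrightarrow> conic_eval q (v \<epsilon> (t i), t i) = 0) \<Longrightarrow> strongly_hyperbolic q"
    unfolding eventually_at_right_field by metis
  have hyp: "strongly_hyperbolic q" if \<epsilon>: "0 < \<epsilon>" "\<epsilon> < \<epsilon>0" and q: "conic_through q (P \<epsilon>)" for \<epsilon> q
  proof -
    define \<sigma> where "\<sigma> = \<epsilon> powr p / p"
    have nz: "\<sigma> \<noteq> 0" "\<epsilon> \<noteq> 0" using \<epsilon> assms(1) by (auto simp: \<sigma>_def)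
    \<comment> \<open>The theorem reads \<open>q\<close> in the coordinates \<open>(x, y)\<close>.
      Since \<open>reflect_conic\<close> also carries equations in \<open>(x, y)\<close> to
      \<open>(u, y)\<close>, \<open>?q\<close> is the same conic in the rescaled coordinates with
      \<open>x = 1 - \<sigma> * v\<close> and \<open>y = \<epsilon> * t\<close>.\<close>
    let ?q = "scale_conic \<sigma> \<epsilon> (reflect_conic q)"
    have "strongly_hyperbolic ?q"
    proof (rule \<epsilon>0[OF \<epsilon>])
      show "?q \<noteq> 0"
        using q nz by (simp add: conic_through_def scale_conic_eq_0 reflect_conic_eq_0)
      show "conic_eval ?q (v \<epsilon> (t i), t i) = 0" if "i < 5" for i
      proof -
        have "(1 - \<sigma> * v \<epsilon> (t i), \<epsilon> * t i) = S_point p (t i * \<epsilon>)"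
          using nz by (simp add: v_def \<sigma>_def S_point_def mult.commute)
        moreover have "conic_eval q (S_point p (t i * \<epsilon>)) = 0"
          using q that by (auto simp: conic_through_def P)
        ultimately show ?thesis by (simp add: conic_eval_scale conic_eval_reflect)
      qed
    qed
    then show ?thesis using nz by (simp add: strongly_hyperbolic_scale strongly_hyperbolic_reflect)
  qed
  show "\<exists>\<epsilon>0>0. \<forall>\<epsilon>. 0 < \<epsilon> \<and> \<epsilon> < \<epsilon>0 \<and> \<epsilon> < inverse t5 \<longrightarrow>
      (\<exists>q. conic_through q (P \<epsilon>) \<and> (\<forall>q'. conic_through q' (P \<epsilon>) \<longrightarrow> same_conic q q') \<and>
           nondegenerate_hyperbola q)"
  proof (intro exI[of _ \<epsilon>0] conjI allI impI \<open>\<epsilon>0 > 0\<close>)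
    fix \<epsilon> assume "0 < \<epsilon> \<and> \<epsilon> < \<epsilon>0 \<and> \<epsilon> < inverse t5"
    then have \<epsilon>: "0 < \<epsilon>" "\<epsilon> < \<epsilon>0" by auto
    have "card (P \<epsilon>) \<le> 5" unfolding P using card_image_le[of "{..<5::nat}"] by force
    then obtain q where q: "conic_through q (P \<epsilon>)" using ex_conic_through[of "P \<epsilon>"] by (auto simp: P)
    \<comment> \<open>\<open>hyp\<close> covers every conic through the points, so it supplies both
      the type of \<open>q\<close> and the hypothesis of the uniqueness lemma.\<close>
    with hyp[OF \<epsilon>] show "\<exists>q. conic_through q (P \<epsilon>) \<and> (\<forall>q'. conic_through q' (P \<epsilon>) \<longrightarrow> same_conic q q') \<and>
        nondegenerate_hyperbola q"
      by (meson same_conic_if_all_strongly_hyperbolic strongly_hyperbolic_imp_nondegenerate_hyperbola)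
  qed
qed

end
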